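(* Let $O$ and $P$ be finite posets on disjoint ground sets. Then for every nonnegative integer $m$, $$e(m,O+P)=e(m,O)\cdot e(m,P),$$ and, provided $O$ is nonempty, $$e(m,O\oplus P)=\sum_{j=1}^{d(O)} c(j,O)\,(j+d(P)-1)^m .$$
   Context: For posets $O$ on $X$ and $P$ on $Y$ with $X\cap Y=\emptyset$: the cardinal sum $O+P$ is the poset on $X\cup Y$ with order $\le_O\cup\le_P$; the ordinal sum $O\oplus P$ has order $\le_O\cup\le_P\cup(X\times Y)$ (every element of $X$ below every element of $Y$). For a finite poset $P$ on $K$ and a finite set $M$ disjoint from $K$ with $|M|=m$, $e(m,P)$ is the number of partial orders on $M\cup K$ inducing $P$ on $K$ whose set of minimal elements is exactly $M$. $d(\cdot)$ is the number of downsets. For a finite poset $O$, $c(j,O)=\sum_{i}(-1)^i\,|\{B\subseteq\operatorname{Min}O\mid |B|=i,\ d(O-B)=j\}|$, where $\operatorname{Min}O$ is the set of minimal elements and $O-B$ the subposet induced on the complement of $B$. *)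

theory Defs
  imports Main
begin

text \<open>
  A poset is given by its ground set \<open>X\<close> and an order relation \<open>R\<close> with
  \<^term>\<open>partial_order_on X R\<close>; \<open>(x, y) \<in> R\<close> means \<open>x \<le> y\<close>.
  Both sums of posets have the union of the two ground sets as ground set.
\<close>

definition cardinal_sum :: "'a rel \<Rightarrow> 'a rel \<Rightarrow> 'a rel" where
  "cardinal_sum R S = R \<union> S"

definition ordinal_sum :: "'a set \<Rightarrow> 'a rel \<Rightarrow> 'a set \<Rightarrow> 'a rel \<Rightarrow> 'a rel" where
  "ordinal_sum X R Y S = R \<union> S \<union> X \<times> Y"

definition min_elems :: "'a set \<Rightarrow> 'a rel \<Rightarrow> 'a set" where
  "min_elems X R = {x \<in> X. \<forall>y\<in>X. (y, x) \<in> R \<longrightarrow> y = x}"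

definition downsets :: "'a set \<Rightarrow> 'a rel \<Rightarrow> 'a set set" where
  "downsets X R = {D. D \<subseteq> X \<and> (\<forall>x\<in>D. \<forall>y\<in>X. (y, x) \<in> R \<longrightarrow> y \<in> D)}"

definition num_downsets :: "'a set \<Rightarrow> 'a rel \<Rightarrow> nat" where
  "num_downsets X R = card (downsets X R)"

definition min_extensions :: "'a set \<Rightarrow> 'a set \<Rightarrow> 'a rel \<Rightarrow> 'a rel set" where
  "min_extensions M K R =
     {T. partial_order_on (M \<union> K) T \<and> Restr T K = R \<and> min_elems (M \<union> K) T = M}"

text \<open>
  The number \<open>e(m, P)\<close> does not depend on the choice of the \<open>m\<close>-element set \<open>M\<close> disjoint from
  \<open>K\<close>. As the type \<open>'a\<close> need not have room for such a set, it is defined with the copy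
  \<open>Inr ` {..<m}\<close> in the sum type; lemma \<open>num_min_extensions_eq\<close> below shows that every other
  choice gives the same number.
\<close>

definition num_min_extensions :: "nat \<Rightarrow> 'a set \<Rightarrow> 'a rel \<Rightarrow> nat" where
  "num_min_extensions m K R =
     card (min_extensions (Inr ` {..<m} :: ('a + nat) set) (Inl ` K) (map_prod Inl Inl ` R))"

definition c_coeff :: "nat \<Rightarrow> 'a set \<Rightarrow> 'a rel \<Rightarrow> int" where
  "c_coeff j X R =
     (\<Sum>i\<le>card (min_elems X R).
        (-1) ^ i * int (card {B. B \<subseteq> min_elems X R \<and> card B = i \<and>
                                 num_downsets (X - B) (Restr R (X - B)) = j}))"

lemma partial_order_on_cardinal_sum:
  assumes "partial_order_on X R" "partial_order_on Y S" "X \<inter> Y = {}"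
  shows "partial_order_on (X \<union> Y) (cardinal_sum R S)"
proof -
  note R = partial_order_onD[OF assms(1)] and S = partial_order_onD[OF assms(2)]
  have "trans (R \<union> S)"
    using R(2,4) S(2,4) assms(3) unfolding trans_def by blast
  moreover have "antisym (R \<union> S)"
    using R(3,4) S(3,4) assms(3) unfolding antisym_def by blast
  ultimately show ?thesis
    using R(1,4) S(1,4)
    by (auto simp: partial_order_on_def preorder_on_def cardinal_sum_def refl_on_def)
qed

lemma partial_order_on_ordinal_sum:
  assumes "partial_order_on X R" "partial_order_on Y S" "X \<inter> Y = {}"
  shows "partial_order_on (X \<union> Y) (ordinal_sum X R Y S)"
proof -
  note R = partial_order_onD[OF assms(1)] and S = partial_order_onD[OF assms(2)]
  have "trans (R \<union> S \<union> X \<times> Y)"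
    using R(2,4) S(2,4) assms(3) unfolding trans_def by blast
  moreover have "antisym (R \<union> S \<union> X \<times> Y)"
    using R(3,4) S(3,4) assms(3) unfolding antisym_def by blast
  ultimately show ?thesis
    using R(1,4) S(1,4)
    by (auto simp: partial_order_on_def preorder_on_def ordinal_sum_def refl_on_def)
qed

lemma min_extensions_image:
  assumes f: "inj_on f (M \<union> K)" and R: "R \<subseteq> K \<times> K" and T: "T \<in> min_extensions M K R"
  shows "map_prod f f ` T \<in> min_extensions (f ` M) (f ` K) (map_prod f f ` R)"
proof -
  let ?A = "M \<union> K" and ?T = "map_prod f f ` T"
  have po: "partial_order_on ?A T" and res: "Restr T K = R" and mn: "min_elems ?A T = M"
    using T by (auto simp: min_extensions_def)
  note p = partial_order_onD[OF po]
  have iff: "(f x, f y) \<in> ?T \<longleftrightarrow> (x, y) \<in> T" if "x \<in> ?A" "y \<in> ?A" for x y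
  proof
    assume "(f x, f y) \<in> ?T"
    then obtain u v where uv: "(u, v) \<in> T" "f x = f u" "f y = f v" by auto
    moreover from uv have "u \<in> ?A" "v \<in> ?A" using p(4) by auto
    ultimately show "(x, y) \<in> T" using that inj_onD[OF f] by metis
  qed force
  have sub: "?T \<subseteq> f ` ?A \<times> f ` ?A" using p(4) by auto
  have "trans ?T"
  proof (rule transI)
    fix a b c assume ab: "(a, b) \<in> ?T" and bc: "(b, c) \<in> ?T"
    obtain x y z where *: "x \<in> ?A" "y \<in> ?A" "z \<in> ?A" "a = f x" "b = f y" "c = f z"
    proof -
      have "a \<in> f ` ?A" "b \<in> f ` ?A" "c \<in> f ` ?A" using ab bc subsetD[OF sub] by auto
      then show ?thesis using that by (elim imageE)
    qed
    show "(a, c) \<in> ?T" using ab bc transD[OF p(2)] unfolding *(4-6) iff[OF *(1,2)]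
        iff[OF *(2,3)] iff[OF *(1,3)] by blast
  qed
  moreover have "antisym ?T"
  proof (rule antisymI)
    fix a b assume ab: "(a, b) \<in> ?T" and ba: "(b, a) \<in> ?T"
    obtain x y where *: "x \<in> ?A" "y \<in> ?A" "a = f x" "b = f y"
    proof -
      have "a \<in> f ` ?A" "b \<in> f ` ?A" using ab subsetD[OF sub] by auto
      then show ?thesis using that by (elim imageE)
    qed
    show "a = b" using ab ba antisymD[OF p(3)] unfolding *(3-4) iff[OF *(1,2)]
        iff[OF *(2,1)] by blast
  qed
  moreover have "refl_on (f ` ?A) ?T"
    using p(1) by (force simp: refl_on_def)
  ultimately have 1: "partial_order_on (f ` M \<union> f ` K) ?T"
    using sub by (simp add: partial_order_on_def preorder_on_def image_Un)
  have 2: "Restr ?T (f ` K) = map_prod f f ` R"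
  proof (intro equalityI subsetI)
    fix q assume q: "q \<in> Restr ?T (f ` K)"
    then obtain x y where *: "x \<in> K" "y \<in> K" "q = (f x, f y)" by blast
    then have "(x, y) \<in> T" using q iff[of x y] by auto
    then have "(x, y) \<in> R" using * res by blast
    then show "q \<in> map_prod f f ` R" using * by force
  next
    fix q assume "q \<in> map_prod f f ` R"
    then show "q \<in> Restr ?T (f ` K)" using res by auto
  qed
  have "min_elems (f ` ?A) ?T = f ` min_elems ?A T"
  proof -
    have "f x \<in> min_elems (f ` ?A) ?T \<longleftrightarrow> x \<in> min_elems ?A T" if "x \<in> ?A" for x
      using that iff inj_on_eq_iff[OF f] by (simp add: min_elems_def ball_Un)
    moreover have "min_elems (f ` ?A) ?T \<subseteq> f ` ?A" "min_elems ?A T \<subseteq> ?A"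
      unfolding min_elems_def by blast+
    ultimately show ?thesis by blast
  qed
  then have 3: "min_elems (f ` M \<union> f ` K) ?T = f ` M"
    using mn by (simp add: image_Un)
  show ?thesis using 1 2 3 by (simp add: min_extensions_def)
qed

lemma min_extensions_subset:
  "T \<in> min_extensions M K R \<Longrightarrow> T \<subseteq> (M \<union> K) \<times> (M \<union> K)"
  by (simp add: min_extensions_def partial_order_on_def preorder_on_def)

lemma card_min_extensions_image:
  assumes f: "inj_on f (M \<union> K)" and R: "R \<subseteq> K \<times> K"
  shows "card (min_extensions (f ` M) (f ` K) (map_prod f f ` R)) = card (min_extensions M K R)"
proof -
  define g where "g = inv_into (M \<union> K) f"
  have gf: "g (f x) = x" if "x \<in> M \<union> K" for x
    unfolding g_def using inv_into_f_f[OF f that] .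
  have inv1: "map_prod g g ` map_prod f f ` T = T" if "T \<subseteq> (M \<union> K) \<times> (M \<union> K)" for T
  proof -
    have "map_prod g g (map_prod f f q) = q" if "q \<in> T" for q
      using that \<open>T \<subseteq> _\<close> gf by (cases q) auto
    then show ?thesis by (force simp: image_image)
  qed
  have inv2: "map_prod f f ` map_prod g g ` T = T"
    if "T \<subseteq> (f ` M \<union> f ` K) \<times> (f ` M \<union> f ` K)" for T
  proof -
    have "map_prod f f (map_prod g g q) = q" if "q \<in> T" for q
      using that \<open>T \<subseteq> _\<close> gf by (cases q) auto
    then show ?thesis by (force simp: image_image)
  qed
  have gM: "g ` f ` M = M" and gK: "g ` f ` K = K"
    using gf by (force simp: image_image)+
  have gR: "map_prod g g ` map_prod f f ` R = R"
    using R by (intro inv1) blast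
  have g: "inj_on g (f ` M \<union> f ` K)"
    using gf by (intro inj_onI) auto
  have "bij_betw ((`) (map_prod f f)) (min_extensions M K R)
          (min_extensions (f ` M) (f ` K) (map_prod f f ` R))"
  proof (rule bij_betw_byWitness[where f' = "(`) (map_prod g g)"])
    show "(`) (map_prod f f) ` min_extensions M K R
            \<subseteq> min_extensions (f ` M) (f ` K) (map_prod f f ` R)"
      using min_extensions_image[OF f R] by blast
    have "map_prod f f ` R \<subseteq> f ` K \<times> f ` K" using R by auto
    from min_extensions_image[OF g this]
    show "(`) (map_prod g g) ` min_extensions (f ` M) (f ` K) (map_prod f f ` R)
            \<subseteq> min_extensions M K R"
      unfolding gM gK gR by blast
    show "\<forall>T\<in>min_extensions M K R. map_prod g g ` map_prod f f ` T = T"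
      by (intro ballI inv1) (rule min_extensions_subset)
    show "\<forall>T\<in>min_extensions (f ` M) (f ` K) (map_prod f f ` R).
            map_prod f f ` map_prod g g ` T = T"
      by (intro ballI inv2) (rule min_extensions_subset)
  qed
  from bij_betw_same_card[OF this] show ?thesis by simp
qed

lemma num_min_extensions_eq:
  assumes "partial_order_on K R" "finite M" "M \<inter> K = {}"
  shows "num_min_extensions (card M) K R = card (min_extensions M K R)"
proof -
  obtain h where h: "bij_betw h M {..<card M}"
    using \<open>finite M\<close> ex_bij_betw_finite_nat[of M] by (auto simp: atLeast0LessThan)
  define f where "f x = (if x \<in> M then Inr (h x) else Inl x)" for x
  have R: "R \<subseteq> K \<times> K" using partial_order_onD(4)[OF assms(1)] .
  have "inj_on f (M \<union> K)"
    using h assms(3) by (auto simp: f_def inj_on_def bij_betw_def)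
  moreover have "f ` M = Inr ` {..<card M}"
  proof -
    have "f ` M = Inr ` h ` M" unfolding image_image by (intro image_cong) (auto simp: f_def)
    then show ?thesis using h by (simp add: bij_betw_def)
  qed
  moreover have fK: "f x = Inl x" if "x \<in> K" for x
    using that assms(3) by (auto simp: f_def)
  then have "f ` K = Inl ` K" by (intro image_cong) auto
  moreover have "map_prod f f ` R = map_prod Inl Inl ` R"
    using R fK by (intro image_cong) auto
  ultimately show ?thesis
    using card_min_extensions_image[of f M K R] R by (simp add: num_min_extensions_def)
qed

end

theory Submission
  imports Defs "HOL-Library.FuncSet"
begin

text \<open>
  In an extension of \<open>P\<close> with \<open>M\<close> as its set of minimal elements, each new element \<open>i\<close> is
  described by the downset of those elements of \<open>K\<close> that are not above \<open>i\<close>, and an arbitrary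
  family of downsets arises in this way iff no minimal element of \<open>P\<close> lies in all of them. For
  a cardinal sum such families are pairs of families. For an ordinal sum one applies
  inclusion-exclusion over the sets \<open>B\<close> of minimal elements lying in all members of the family:
  the downsets containing \<open>B\<close> correspond to the downsets of \<open>(O - B) \<oplus> P\<close>, of which there are
  \<open>d(O - B) + d(P) - 1\<close>.
\<close>

section \<open>Extensions with prescribed minimal elements as families of downsets\<close>

definition downset_families :: "nat \<Rightarrow> 'a set \<Rightarrow> 'a rel \<Rightarrow> (nat \<Rightarrow> 'a set) set" where
  "downset_families m K R =
     {f \<in> {..<m} \<rightarrow>\<^sub>E downsets K R. \<forall>x\<in>min_elems K R. \<exists>i<m. x \<notin> f i}"

lemma finite_downsets: "finite X \<Longrightarrow> finite (downsets X R)"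
  by (rule finite_subset[of _ "Pow X"]) (auto simp: downsets_def)

lemma finite_min_elems: "finite X \<Longrightarrow> finite (min_elems X R)"
  by (simp add: min_elems_def)

text \<open>Among the elements below \<open>k\<close>, one with the fewest elements below it is
  minimal. This carries the condition on families from minimal elements to all of \<open>K\<close>:
  whatever new element lies below \<open>x\<close> also lies below \<open>k\<close>.\<close>

lemma ex_min_elem_below:
  assumes "finite K" "partial_order_on K R" "k \<in> K"
  obtains x where "x \<in> min_elems K R" "(x, k) \<in> R"
proof -
  note p = partial_order_onD[OF assms(2)]
  define A where "A x = {y. (y, x) \<in> R}" for x
  have fin: "finite (A x)" for x
    using finite_subset[of "A x" K] p(4) assms(1) by (auto simp: A_def)
  have "(k, k) \<in> R" using p(1) assms(3) by (auto simp: refl_on_def)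
  then obtain x where x: "(x, k) \<in> R" and least: "\<And>y. (y, k) \<in> R \<Longrightarrow> card (A x) \<le> card (A y)"
    using ex_has_least_nat[of "\<lambda>x. (x, k) \<in> R" k "card \<circ> A"] by auto
  have "y = x" if "(y, x) \<in> R" for y
  proof (rule ccontr)
    assume "y \<noteq> x"
    \<comment> \<open>Inclusion is transitivity; it is strict because \<open>x\<close> lies in
      \<open>A x\<close> by reflexivity but not in \<open>A y\<close> by antisymmetry.\<close>
    then have "A y \<subset> A x"
      using that p(1) transD[OF p(2)] antisymD[OF p(3)] p(4)
      unfolding A_def refl_on_def by blast
    then have "card (A y) < card (A x)" using fin psubset_card_mono by blast
    moreover have "(y, k) \<in> R" using that x transD[OF p(2)] by blast
    ultimately show False using least by fastforce
  qed
  then have "x \<in> min_elems K R" using x p(4) by (auto simp: min_elems_def)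
  with x show thesis using that by blast
qed

definition extension_of_family :: "nat \<Rightarrow> 'a set \<Rightarrow> 'a rel \<Rightarrow> (nat \<Rightarrow> 'a set) \<Rightarrow> ('a + nat) rel" where
  "extension_of_family m K R f =
     map_prod Inl Inl ` R \<union> (\<lambda>i. (Inr i, Inr i)) ` {..<m} \<union>
     {(Inr i, Inl k) | i k. i < m \<and> k \<in> K \<and> k \<notin> f i}"

text \<open>The restriction to \<open>{..<m}\<close> fixes the values outside the index range, so
  that families form a finite set and this map can be an exact inverse of
  \<open>extension_of_family\<close>.\<close>

definition family_of_extension :: "nat \<Rightarrow> 'a set \<Rightarrow> ('a + nat) rel \<Rightarrow> nat \<Rightarrow> 'a set" where
  "family_of_extension m K T = (\<lambda>i\<in>{..<m}. {k \<in> K. (Inr i, Inl k) \<notin> T})"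

lemma mem_extension_of_family:
  "(Inl a, Inl b) \<in> extension_of_family m K R f \<longleftrightarrow> (a, b) \<in> R"
  "(Inl a, Inr j) \<notin> extension_of_family m K R f"
  "(Inr i, Inr j) \<in> extension_of_family m K R f \<longleftrightarrow> i < m \<and> i = j"
  "(Inr i, Inl b) \<in> extension_of_family m K R f \<longleftrightarrow> i < m \<and> b \<in> K \<and> b \<notin> f i"
  by (auto simp: extension_of_family_def)

text \<open>Transitivity holds because the complement of a downset is closed upwards. The condition
  on minimal elements of \<open>R\<close> ensures that no old element remains minimal.\<close>

lemma extension_of_family_mem:
  assumes "finite K" "partial_order_on K R" "f \<in> downset_families m K R"
  shows "extension_of_family m K R f
           \<in> min_extensions (Inr ` {..<m}) (Inl ` K) (map_prod Inl Inl ` R)"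
proof -
  note p = partial_order_onD[OF assms(2)]
  let ?T = "extension_of_family m K R f" and ?A = "Inr ` {..<m} \<union> Inl ` K :: ('a + nat) set"
  have fd: "f i \<in> downsets K R" if "i < m" for i
    using assms(3) that by (auto simp: downset_families_def)
  have cov: "\<exists>i<m. x \<notin> f i" if "x \<in> min_elems K R" for x
    using assms(3) that by (auto simp: downset_families_def)
  have sub: "?T \<subseteq> ?A \<times> ?A" using p(4) by (auto simp: extension_of_family_def)
  have up: "b \<notin> f i" if "i < m" "a \<notin> f i" "(a, b) \<in> R" for a b i
    using fd[OF that(1)] that p(4) unfolding downsets_def by blast
  have "refl_on ?A ?T"
    using p(1) by (auto simp: refl_on_def mem_extension_of_family)
  moreover have "trans ?T"
  proof (rule transI)
    fix u v w assume "(u, v) \<in> ?T" "(v, w) \<in> ?T"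
    then show "(u, w) \<in> ?T"
      using subsetD[OF p(4)]
      by (cases u; cases v; cases w)
        (auto simp: mem_extension_of_family dest: transD[OF p(2)] up)
  qed
  moreover have "antisym ?T"
  proof (rule antisymI)
    fix u v assume "(u, v) \<in> ?T" "(v, u) \<in> ?T"
    then show "u = v"
      by (cases u; cases v) (auto simp: mem_extension_of_family dest: antisymD[OF p(3)])
  qed
  ultimately have "partial_order_on ?A ?T"
    using sub by (simp add: partial_order_on_def preorder_on_def)
  moreover have "Restr ?T (Inl ` K) = map_prod Inl Inl ` R"
    using p(4) by (auto simp: extension_of_family_def)
  moreover have "min_elems ?A ?T = Inr ` {..<m}"
  proof -
    have "Inr i \<in> min_elems ?A ?T" if "i < m" for i
      using that by (auto simp: min_elems_def mem_extension_of_family)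
    \<comment> \<open>A minimal \<open>x\<close> below \<open>k\<close> is missed by some
      \<open>f i\<close>; upward closure of the complement then puts the new element
      \<open>i\<close> below \<open>k\<close>.\<close>
    moreover have "Inl k \<notin> min_elems ?A ?T" for k
    proof
      assume k: "Inl k \<in> min_elems ?A ?T"
      then have "k \<in> K" by (auto simp: min_elems_def)
      then obtain x where x: "x \<in> min_elems K R" "(x, k) \<in> R"
        using ex_min_elem_below[OF assms(1,2)] by blast
      from cov[OF x(1)] obtain i where i: "i < m" "x \<notin> f i" by blast
      have "k \<notin> f i" using up[OF i x(2)] .
      then have "(Inr i, Inl k) \<in> ?T"
        using i \<open>k \<in> K\<close> by (simp add: mem_extension_of_family)
      then show False using k i(1) unfolding min_elems_def by blast
    qed
    moreover have "min_elems ?A ?T \<subseteq> ?A" by (auto simp: min_elems_def)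
    ultimately show ?thesis by blast
  qed
  ultimately show ?thesis by (simp add: min_extensions_def)
qed

text \<open>Minimality of the new elements leaves only the pairs \<open>(Inr i, Inl k)\<close>
  undetermined by \<open>R\<close>, and these are what the family records. Transitivity of
  \<open>T\<close> makes its members downsets.\<close>

lemma
  assumes po: "partial_order_on K R"
    and T: "T \<in> min_extensions (Inr ` {..<m}) (Inl ` K) (map_prod Inl Inl ` R)"
  shows family_of_extension_mem: "family_of_extension m K T \<in> downset_families m K R"
    and extension_of_family_of_extension:
      "extension_of_family m K R (family_of_extension m K T) = T"
proof -
  let ?A = "Inr ` {..<m} \<union> Inl ` K :: ('a + nat) set" and ?f = "family_of_extension m K T"
  have poT: "partial_order_on ?A T" and res: "Restr T (Inl ` K) = map_prod Inl Inl ` R"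
    and mn: "min_elems ?A T = Inr ` {..<m}"
    using T by (auto simp: min_extensions_def)
  note p = partial_order_onD[OF poT] and pR = partial_order_onD[OF po]
  have LL: "(Inl a, Inl b) \<in> T \<longleftrightarrow> (a, b) \<in> R" for a b
  proof
    assume "(Inl a, Inl b) \<in> T"
    then have "(Inl a, Inl b) \<in> Restr T (Inl ` K)" using p(4) by auto
    then show "(a, b) \<in> R" unfolding res by auto
  next
    assume "(a, b) \<in> R"
    then have "(Inl a, Inl b) \<in> Restr T (Inl ` K)" unfolding res by force
    then show "(Inl a, Inl b) \<in> T" by blast
  qed
  have R: "u = Inr i" if "(u, Inr i) \<in> T" for u i
  proof -
    have "u \<in> ?A" "Inr i \<in> ?A" using subsetD[OF p(4) that] by blast+
    then have "Inr i \<in> min_elems ?A T" using mn by auto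
    then show ?thesis using that \<open>u \<in> ?A\<close> unfolding min_elems_def by blast
  qed
  show "?f \<in> downset_families m K R"
  proof -
    have "?f i \<in> downsets K R" if "i < m" for i
      using that transD[OF p(2)] LL
      by (simp add: family_of_extension_def downsets_def) blast
    moreover have "\<exists>i<m. x \<notin> ?f i" if x: "x \<in> min_elems K R" for x
    proof -
      have xK: "x \<in> K" using x by (simp add: min_elems_def)
      \<comment> \<open>Although minimal in \<open>R\<close>, \<open>x\<close> is not minimal in
        \<open>T\<close>, so something else lies below it, and this can only be a new
        element.\<close>
      have "Inl x \<notin> min_elems ?A T" unfolding mn by blast
      then obtain u where u: "u \<in> ?A" "(u, Inl x) \<in> T" "u \<noteq> Inl x"
        using xK by (auto simp: min_elems_def)
      then obtain i where "i < m" "u = Inr i"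
        using x LL by (auto simp: min_elems_def)
      with u show ?thesis by (auto simp: family_of_extension_def)
    qed
    moreover have "?f \<in> extensional {..<m}" by (simp add: family_of_extension_def)
    ultimately show ?thesis by (auto simp: downset_families_def PiE_def)
  qed
  show "extension_of_family m K R ?f = T"
  proof -
    have lt: "i < m" if "(Inr i, v) \<in> T" for i v
      using subsetD[OF p(4) that] by auto
    have ltK: "k \<in> K" if "(u, Inl k) \<in> T" for u k
      using subsetD[OF p(4) that] by auto
    have rf: "(Inr i, Inr i) \<in> T" if "i < m" for i
      using p(1) that by (auto simp: refl_on_def)
    have "(u, v) \<in> extension_of_family m K R ?f \<longleftrightarrow> (u, v) \<in> T" for u v
      using LL R lt ltK rf
      by (cases u; cases v) (auto simp: mem_extension_of_family family_of_extension_def)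
    then show ?thesis by auto
  qed
qed

lemma family_of_extension_of_family:
  assumes "f \<in> downset_families m K R"
  shows "family_of_extension m K (extension_of_family m K R f) = f"
proof
  fix i
  have "f \<in> extensional {..<m}" "i < m \<Longrightarrow> f i \<subseteq> K"
    using assms by (auto simp: downset_families_def downsets_def PiE_def)
  then show "family_of_extension m K (extension_of_family m K R f) i = f i"
    by (auto simp: family_of_extension_def mem_extension_of_family extensional_def)
qed

lemma num_min_extensions_eq_card_families:
  assumes "finite K" "partial_order_on K R"
  shows "num_min_extensions m K R = card (downset_families m K R)"
proof -
  have "bij_betw (extension_of_family m K R) (downset_families m K R)
          (min_extensions (Inr ` {..<m}) (Inl ` K) (map_prod Inl Inl ` R))"
    by (rule bij_betw_byWitness[where f' = "family_of_extension m K"])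
      (simp_all add: assms image_subset_iff extension_of_family_mem family_of_extension_mem
        extension_of_family_of_extension family_of_extension_of_family)
  from bij_betw_same_card[OF this] show ?thesis by (simp add: num_min_extensions_def)
qed

section \<open>Cardinal sums\<close>

lemma min_elems_cardinal_sum:
  assumes "R \<subseteq> X \<times> X" "S \<subseteq> Y \<times> Y" "X \<inter> Y = {}"
  shows "min_elems (X \<union> Y) (cardinal_sum R S) = min_elems X R \<union> min_elems Y S"
  using assms unfolding min_elems_def cardinal_sum_def by blast

lemma downsets_cardinal_sum:
  assumes "R \<subseteq> X \<times> X" "S \<subseteq> Y \<times> Y" "X \<inter> Y = {}"
  shows "D \<in> downsets (X \<union> Y) (cardinal_sum R S) \<longleftrightarrow>
           D \<subseteq> X \<union> Y \<and> D \<inter> X \<in> downsets X R \<and> D \<inter> Y \<in> downsets Y S"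
  using assms unfolding downsets_def cardinal_sum_def by blast

text \<open>Intersecting each member with \<open>X\<close> and with \<open>Y\<close> splits a family
  into two independent ones. The condition on minimal elements splits as well, since membership of
  an element of one ground set depends only on the part in that set.\<close>

lemma card_downset_families_cardinal_sum:
  assumes R: "R \<subseteq> X \<times> X" and S: "S \<subseteq> Y \<times> Y" and disj: "X \<inter> Y = {}"
  shows "card (downset_families m (X \<union> Y) (cardinal_sum R S))
           = card (downset_families m X R) * card (downset_families m Y S)"
proof -
  define split where
    "split f = (\<lambda>i\<in>{..<m}. f i \<inter> X, \<lambda>i\<in>{..<m}. f i \<inter> Y)" for f :: "nat \<Rightarrow> 'a set"
  define merge where
    "merge = (\<lambda>(g, h). \<lambda>i\<in>{..<m}. g i \<union> h i :: 'a set)"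
  note ds = downsets_cardinal_sum[OF assms] and ms = min_elems_cardinal_sum[OF assms]
  have sub: "D \<subseteq> Z" if "D \<in> downsets Z Q" for D Z :: "'a set" and Q
    using that by (simp add: downsets_def)
  have minsub: "min_elems Z Q \<subseteq> Z" for Z :: "'a set" and Q by (auto simp: min_elems_def)
  have cap: "(g \<union> h) \<inter> X = g" "(g \<union> h) \<inter> Y = h" if "g \<subseteq> X" "h \<subseteq> Y" for g h
    using that disj by blast+
  have "bij_betw split (downset_families m (X \<union> Y) (cardinal_sum R S))
          (downset_families m X R \<times> downset_families m Y S)"
  proof (rule bij_betw_byWitness[where f' = merge])
    show "\<forall>f\<in>downset_families m (X \<union> Y) (cardinal_sum R S). merge (split f) = f"
    proof (intro ballI ext)
      fix f i assume f: "f \<in> downset_families m (X \<union> Y) (cardinal_sum R S)"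
      then have "i < m \<Longrightarrow> f i \<subseteq> X \<union> Y" "f \<in> extensional {..<m}"
        by (auto simp: downset_families_def ds PiE_def Pi_def)
      then show "merge (split f) i = f i"
        by (auto simp: merge_def split_def extensional_def)
    qed
    show "\<forall>p\<in>downset_families m X R \<times> downset_families m Y S. split (merge p) = p"
    proof (clarify)
      fix g h assume g: "g \<in> downset_families m X R" and h: "h \<in> downset_families m Y S"
      have gh: "g i \<subseteq> X" "h i \<subseteq> Y" if "i < m" for i
        using g h that by (auto simp: downset_families_def downsets_def PiE_def Pi_def)
      have "g \<in> extensional {..<m}" "h \<in> extensional {..<m}"
        using g h by (auto simp: downset_families_def PiE_def)
      then show "split (merge (g, h)) = (g, h)"
        using cap[OF gh] by (auto simp: merge_def split_def extensional_def fun_eq_iff)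
    qed
    show "split ` downset_families m (X \<union> Y) (cardinal_sum R S)
            \<subseteq> downset_families m X R \<times> downset_families m Y S"
    proof (rule image_subsetI)
      fix f assume f: "f \<in> downset_families m (X \<union> Y) (cardinal_sum R S)"
      have "f i \<inter> X \<in> downsets X R" "f i \<inter> Y \<in> downsets Y S" if "i < m" for i
        using f that by (auto simp: downset_families_def ds PiE_def Pi_def)
      moreover have "\<exists>i<m. x \<notin> f i" if "x \<in> min_elems X R \<union> min_elems Y S" for x
        using f that unfolding downset_families_def ms by blast
      ultimately show "split f \<in> downset_families m X R \<times> downset_families m Y S"
        by (fastforce simp: downset_families_def split_def)
    qed
    show "merge ` (downset_families m X R \<times> downset_families m Y S)
            \<subseteq> downset_families m (X \<union> Y) (cardinal_sum R S)"
    proof clarify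
      fix g h assume g: "g \<in> downset_families m X R" and h: "h \<in> downset_families m Y S"
      have gh: "g i \<in> downsets X R" "h i \<in> downsets Y S" if "i < m" for i
        using g h that by (auto simp: downset_families_def PiE_def Pi_def)
      have "g i \<union> h i \<in> downsets (X \<union> Y) (cardinal_sum R S)" if "i < m" for i
        unfolding ds using gh[OF that] cap[of "g i" "h i"] sub by auto
      \<comment> \<open>An index that works for the summand containing \<open>x\<close> works for
        the union, as the other part lies in the disjoint ground set.\<close>
      moreover have "\<exists>i<m. x \<notin> g i \<union> h i" if "x \<in> min_elems X R \<union> min_elems Y S" for x
      proof -
        have "\<exists>i<m. x \<notin> g i" if "x \<in> min_elems X R"
          using g that by (auto simp: downset_families_def)
        moreover have "\<exists>i<m. x \<notin> h i" if "x \<in> min_elems Y S"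
          using h that by (auto simp: downset_families_def)
        ultimately show ?thesis
          using that gh sub minsub disj by blast
      qed
      ultimately show "merge (g, h) \<in> downset_families m (X \<union> Y) (cardinal_sum R S)"
        by (auto simp: merge_def downset_families_def ms)
    qed
  qed
  from bij_betw_same_card[OF this] show ?thesis by (simp add: card_cartesian_product)
qed

section \<open>Inclusion-exclusion over sets of minimal elements\<close>

text \<open>Adjoining a fixed element to the subsets avoiding it flips the sign, so the two halves
  of the power set cancel.\<close>

lemma sum_Pow_neg_one_power_card:
  assumes "finite A"
  shows "(\<Sum>B\<in>Pow A. (-1) ^ card B) = (if A = {} then 1 else 0 :: int)"
  using assms
proof (induction A rule: finite_induct)
  case (insert x A)
  have "(\<Sum>B\<in>Pow (insert x A). (-1) ^ card B :: int)
          = (\<Sum>B\<in>Pow A. (-1) ^ card B) + (\<Sum>B\<in>insert x ` Pow A. (-1) ^ card B)"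
    unfolding Pow_insert using insert by (intro sum.union_disjoint) auto
  also have "(\<Sum>B\<in>insert x ` Pow A. (-1) ^ card B :: int) = (\<Sum>B\<in>Pow A. - ((-1) ^ card B))"
  proof (subst sum.reindex)
    show "inj_on (insert x) (Pow A)" using insert(2) by (auto simp: inj_on_def)
    show "sum ((\<lambda>B. (-1) ^ card B :: int) \<circ> insert x) (Pow A) = (\<Sum>B\<in>Pow A. - ((-1) ^ card B))"
    proof (rule sum.cong)
      fix B assume "B \<in> Pow A"
      then have "finite B" "x \<notin> B" using insert(1,2) finite_subset by auto
      then show "((\<lambda>B. (-1) ^ card B :: int) \<circ> insert x) B = - ((-1) ^ card B)" by simp
    qed simp
  qed
  finally show ?case by (simp add: sum_negf)
qed simp

text \<open>Deleting \<open>B\<close> and adding it back are inverse to each other; adding it back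
  preserves downsets because nothing lies strictly below an element of \<open>B\<close>.\<close>

lemma card_downsets_superset_min:
  assumes "B \<subseteq> min_elems K R"
  shows "card {D \<in> downsets K R. B \<subseteq> D} = num_downsets (K - B) (Restr R (K - B))"
proof -
  have "bij_betw (\<lambda>D. D - B) {D \<in> downsets K R. B \<subseteq> D} (downsets (K - B) (Restr R (K - B)))"
  proof (rule bij_betw_byWitness[where f' = "\<lambda>D. D \<union> B"])
    show "(\<lambda>D. D \<union> B) ` downsets (K - B) (Restr R (K - B)) \<subseteq> {D \<in> downsets K R. B \<subseteq> D}"
      using assms unfolding downsets_def min_elems_def by blast
  qed (auto simp: downsets_def)
  from bij_betw_same_card[OF this] show ?thesis by (simp add: num_downsets_def)
qed

text \<open>The indicator of "no minimal element is common to all members" is expanded as an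
  alternating sum over sets of common minimal elements. After interchanging the sums, each
  \<open>B\<close> contributes the families whose \<open>m\<close> members are chosen independently
  among the downsets containing \<open>B\<close>.\<close>

lemma card_downset_families_incl_excl:
  assumes "finite K"
  shows "int (card (downset_families m K R))
           = (\<Sum>B\<in>Pow (min_elems K R).
                (-1) ^ card B * int (num_downsets (K - B) (Restr R (K - B))) ^ m)"
proof -
  let ?A = "min_elems K R" and ?F = "{..<m} \<rightarrow>\<^sub>E downsets K R"
  \<comment> \<open>For \<open>m = 0\<close> this is all of \<open>?A\<close>, in agreement with the
    failing existential in \<open>downset_families\<close>.\<close>
  let ?cap = "\<lambda>f. {x \<in> ?A. \<forall>i<m. x \<in> f i}"
  have finA: "finite ?A" and finF: "finite ?F"
    using assms by (simp_all add: finite_min_elems finite_downsets finite_PiE)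
  have "downset_families m K R = {f \<in> ?F. ?cap f = {}}"
    unfolding downset_families_def by blast
  then have "int (card (downset_families m K R)) = (\<Sum>f\<in>?F. if ?cap f = {} then 1 else 0)"
    using finF by (simp add: sum.If_cases Int_def)
  also have "\<dots> = (\<Sum>f\<in>?F. \<Sum>B\<in>Pow (?cap f). (-1) ^ card B)"
    using finA by (intro sum.cong refl) (simp add: sum_Pow_neg_one_power_card)
  \<comment> \<open>Writing the subsets of \<open>?cap f\<close> as a restriction of the fixed range
    \<open>Pow ?A\<close> makes the two sums interchangeable.\<close>
  also have "\<dots> = (\<Sum>f\<in>?F. \<Sum>B | B \<in> Pow ?A \<and> (\<forall>i<m. B \<subseteq> f i). (-1) ^ card B)"
    by (intro sum.cong refl) auto
  also have "\<dots> = (\<Sum>B\<in>Pow ?A. \<Sum>f | f \<in> ?F \<and> (\<forall>i<m. B \<subseteq> f i). (-1) ^ card B)"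
    using finA finF by (intro sum.swap_restrict) auto
  also have "\<dots> = (\<Sum>B\<in>Pow ?A.
                (-1) ^ card B * int (num_downsets (K - B) (Restr R (K - B))) ^ m)"
  proof (rule sum.cong)
    fix B assume "B \<in> Pow ?A"
    have "{f. f \<in> ?F \<and> (\<forall>i<m. B \<subseteq> f i)} = {..<m} \<rightarrow>\<^sub>E {D \<in> downsets K R. B \<subseteq> D}"
      by (auto simp: PiE_def Pi_def)
    then have "card {f. f \<in> ?F \<and> (\<forall>i<m. B \<subseteq> f i)} = num_downsets (K - B) (Restr R (K - B)) ^ m"
      using \<open>B \<in> Pow ?A\<close> by (simp add: card_PiE card_downsets_superset_min)
    then show "(\<Sum>f | f \<in> ?F \<and> (\<forall>i<m. B \<subseteq> f i). (-1) ^ card B)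
        = (-1) ^ card B * int (num_downsets (K - B) (Restr R (K - B))) ^ m"
      by (simp add: mult.commute)
  qed simp
  finally show ?thesis .
qed

section \<open>Ordinal sums\<close>

text \<open>Any element of the nonempty \<open>X\<close> lies below every element of
  \<open>Y\<close>, so none of the latter is minimal.\<close>

lemma min_elems_ordinal_sum:
  assumes "R \<subseteq> X \<times> X" "S \<subseteq> Y \<times> Y" "X \<inter> Y = {}" "X \<noteq> {}"
  shows "min_elems (X \<union> Y) (ordinal_sum X R Y S) = min_elems X R"
  using assms unfolding min_elems_def ordinal_sum_def by blast

text \<open>A downset either stays inside \<open>X\<close> or consists of all of \<open>X\<close>
  and a downset of \<open>Y\<close>. Only \<open>X\<close> itself is of both kinds, which accounts
  for the summand 1.\<close>

lemma num_downsets_ordinal_sum: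
  assumes "finite X" "finite Y" "R \<subseteq> X \<times> X" "S \<subseteq> Y \<times> Y" "X \<inter> Y = {}"
  shows "num_downsets (X \<union> Y) (ordinal_sum X R Y S) + 1 = num_downsets X R + num_downsets Y S"
proof -
  have "downsets (X \<union> Y) (ordinal_sum X R Y S) = downsets X R \<union> (\<union>) X ` downsets Y S"
    (is "?D = ?E")
  proof (intro equalityI subsetI)
    fix D assume D: "D \<in> ?D"
    show "D \<in> ?E"
    proof (cases "D \<subseteq> X")
      case True
      then show ?thesis using D unfolding downsets_def ordinal_sum_def by blast
    next
      case False
      \<comment> \<open>An element of \<open>D\<close> outside \<open>X\<close> lies in
        \<open>Y\<close> and has all of \<open>X\<close> below it.\<close>
      then have "X \<subseteq> D" using D unfolding downsets_def ordinal_sum_def by blast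
      then have "D = X \<union> (D \<inter> Y)" using D unfolding downsets_def by blast
      moreover have "D \<inter> Y \<in> downsets Y S"
        using D unfolding downsets_def ordinal_sum_def by blast
      ultimately show ?thesis by blast
    qed
  next
    fix D assume "D \<in> ?E"
    then show "D \<in> ?D"
      using assms(3-5) unfolding downsets_def ordinal_sum_def by blast
  qed
  moreover have "downsets X R \<inter> (\<union>) X ` downsets Y S = {X}"
    using assms(5) unfolding downsets_def by blast
  moreover have "inj_on ((\<union>) X) (downsets Y S)"
    using assms(5) unfolding downsets_def inj_on_def by blast
  ultimately show ?thesis
    using card_Un_Int[of "downsets X R" "(\<union>) X ` downsets Y S"] assms(1,2)
    by (simp add: num_downsets_def finite_downsets card_image)
qed

lemma num_downsets_pos: "finite X \<Longrightarrow> 0 < num_downsets X R"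
  using finite_downsets[of X R]
  by (auto simp: num_downsets_def card_gt_0_iff downsets_def)

text \<open>The left side counts those downsets of \<open>X\<close> that contain
  \<open>B\<close>.\<close>

lemma num_downsets_remove_min_le:
  assumes "finite X" "B \<subseteq> min_elems X R"
  shows "num_downsets (X - B) (Restr R (X - B)) \<le> num_downsets X R"
proof -
  have "card {D \<in> downsets X R. B \<subseteq> D} \<le> num_downsets X R"
    unfolding num_downsets_def using assms(1) by (intro card_mono finite_downsets) auto
  then show ?thesis by (simp add: card_downsets_superset_min[OF assms(2)])
qed

section \<open>The coefficients and the final summation\<close>

text \<open>Sorting the sets \<open>B\<close> by size makes the sign constant on each class. The
  signed sum over sets is the form in which inclusion-exclusion produces the coefficients.\<close>

lemma c_coeff_eq_sum:
  assumes "finite X"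
  shows "c_coeff j X R =
    (\<Sum>B | B \<in> Pow (min_elems X R) \<and> num_downsets (X - B) (Restr R (X - B)) = j. (-1) ^ card B)"
proof -
  let ?P = "{B. B \<in> Pow (min_elems X R) \<and> num_downsets (X - B) (Restr R (X - B)) = j}"
  have fin: "finite (min_elems X R)" using assms by (rule finite_min_elems)
  have "(\<Sum>B\<in>?P. (-1) ^ card B :: int)
      = (\<Sum>i\<le>card (min_elems X R). \<Sum>B | B \<in> ?P \<and> card B = i. (-1) ^ card B)"
    using fin by (intro sum.group[symmetric]) (auto intro: card_mono)
  also have "\<dots> = c_coeff j X R"
    unfolding c_coeff_def
  proof (rule sum.cong)
    fix i
    have "{B. B \<in> ?P \<and> card B = i} = {B. B \<subseteq> min_elems X R \<and> card B = i \<and>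
            num_downsets (X - B) (Restr R (X - B)) = j}" by auto
    then show "(\<Sum>B | B \<in> ?P \<and> card B = i. (-1) ^ card B :: int) =
       (-1) ^ i * int (card {B. B \<subseteq> min_elems X R \<and> card B = i \<and>
            num_downsets (X - B) (Restr R (X - B)) = j})"
      by (auto simp: mult.commute)
  qed simp
  finally show ?thesis by simp
qed

theorem theorem4p4:
  fixes X Y :: "'a set" and R S :: "'a rel"
  assumes "finite X" and "partial_order_on X R"
    and "finite Y" and "partial_order_on Y S"
    and "X \<inter> Y = {}"
  shows "\<forall>m::nat.
           num_min_extensions m (X \<union> Y) (cardinal_sum R S)
             = num_min_extensions m X R * num_min_extensions m Y S \<and>
           (X \<noteq> {} \<longrightarrow>
             int (num_min_extensions m (X \<union> Y) (ordinal_sum X R Y S))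
               = (\<Sum>j = 1..num_downsets X R.
                    c_coeff j X R * (int j + int (num_downsets Y S) - 1) ^ m))"
proof (intro allI conjI impI)
  fix m :: nat
  have R: "R \<subseteq> X \<times> X" and S: "S \<subseteq> Y \<times> Y"
    using partial_order_onD(4) assms(2,4) by blast+
  have fin: "finite (X \<union> Y)" using assms(1,3) by simp
  show "num_min_extensions m (X \<union> Y) (cardinal_sum R S)
          = num_min_extensions m X R * num_min_extensions m Y S"
    using card_downset_families_cardinal_sum[OF R S assms(5)]
      partial_order_on_cardinal_sum[OF assms(2,4,5)] fin assms
    by (simp add: num_min_extensions_eq_card_families)
  assume "X \<noteq> {}"
  let ?O = "ordinal_sum X R Y S" and ?A = "min_elems X R"
  let ?d = "\<lambda>B. num_downsets (X - B) (Restr R (X - B))"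
  let ?g = "\<lambda>j. (int j + int (num_downsets Y S) - 1) ^ m"
  have finA: "finite ?A" using assms(1) by (rule finite_min_elems)
  \<comment> \<open>As the minimal elements of the ordinal sum are those of \<open>X\<close>,
    inclusion-exclusion ranges over subsets of \<open>?A\<close> only.\<close>
  have "int (num_min_extensions m (X \<union> Y) ?O) = (\<Sum>B\<in>Pow ?A.
          (-1) ^ card B * int (num_downsets (X \<union> Y - B) (Restr ?O (X \<union> Y - B))) ^ m)"
    using card_downset_families_incl_excl[OF fin, of m ?O]
      num_min_extensions_eq_card_families[OF fin partial_order_on_ordinal_sum[OF assms(2,4,5)]]
      min_elems_ordinal_sum[OF R S assms(5) \<open>X \<noteq> {}\<close>]
    by simp
  also have "\<dots> = (\<Sum>B\<in>Pow ?A. (-1) ^ card B * ?g (?d B))"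
  proof (rule sum.cong)
    fix B assume "B \<in> Pow ?A"
    then have "B \<subseteq> X" by (auto simp: min_elems_def)
    then have 1: "X \<union> Y - B = (X - B) \<union> Y" using assms(5) by blast
    \<comment> \<open>Deleting \<open>B\<close> affects only the lower summand, so an ordinal sum
      remains. This includes \<open>B = X\<close>, where the empty lower part has one downset and
      the count reduces to that of \<open>Y\<close>.\<close>
    have 2: "Restr ?O ((X - B) \<union> Y) = ordinal_sum (X - B) (Restr R (X - B)) Y S"
      using R S assms(5) unfolding ordinal_sum_def by blast
    have "num_downsets ((X - B) \<union> Y) (ordinal_sum (X - B) (Restr R (X - B)) Y S) + 1
            = ?d B + num_downsets Y S"
      using assms(1,3,5) S by (intro num_downsets_ordinal_sum) auto
    then have "int (num_downsets ((X - B) \<union> Y) (ordinal_sum (X - B) (Restr R (X - B)) Y S))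
            = int (?d B) + int (num_downsets Y S) - 1"
      by linarith
    then show "(-1) ^ card B * int (num_downsets (X \<union> Y - B) (Restr ?O (X \<union> Y - B))) ^ m
            = (-1) ^ card B * ?g (?d B)"
      unfolding 1 2 by simp
  qed simp
  also have "\<dots> = (\<Sum>j = 1..num_downsets X R. \<Sum>B | B \<in> Pow ?A \<and> ?d B = j.
                    (-1) ^ card B * ?g (?d B))"
  proof (rule sum.group[symmetric])
    \<comment> \<open>The empty set is always a downset. With the upper bound for removing minimal
      elements, every value of \<open>?d\<close> lies in the summation range, so grouping by value
      loses no term.\<close>
    have "1 \<le> ?d B" for B
      using num_downsets_pos[of "X - B" "Restr R (X - B)"] assms(1) by simp
    then show "?d ` Pow ?A \<subseteq> {1..num_downsets X R}"
      using num_downsets_remove_min_le[OF assms(1)] by auto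
  qed (use finA in auto)
  also have "\<dots> = (\<Sum>j = 1..num_downsets X R. c_coeff j X R * ?g j)"
    by (intro sum.cong refl) (simp add: c_coeff_eq_sum[OF assms(1)] sum_distrib_right)
  finally show "int (num_min_extensions m (X \<union> Y) ?O)
      = (\<Sum>j = 1..num_downsets X R. c_coeff j X R * ?g j)" .
qed

end
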